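(* Let $(P,\preceq)$ be a locally finite lattice, $f:P\to\mathbb{C}$, and let $S=\{x_1,\dots,x_n\}\subseteq P$ be join-closed, indexed so that $x_i\preceq x_j\Rightarrow i\le j$. If $[S]_f$ is invertible, then its inverse is the $n\times n$ matrix $B=(b_{ij})$ with $$b_{ij}=\sum_{k=1}^n\frac{(-1)^{i+j}}{\Psi_{S,f}(x_k)}\det E(S_i^k)\det E(S_j^k),$$ or equivalently $$b_{ij}=\sum_{x_k\in S,\ x_k\preceq x_i\wedge x_j}\frac{\mu_S(x_k,x_i)\mu_S(x_k,x_j)}{\Psi_{S,f}(x_k)}.$$
   Context: $S$ is join-closed if $x\vee y\in S$ for all $x,y\in S$. $[S]_f$ is the $n\times n$ matrix with $(i,j)$ entry $f(x_i\vee x_j)$. $\Psi_{S,f}$ is the function on $S$ defined recursively by $\Psi_{S,f}(x_k)=f(x_k)-\sum_{x_v\in S,\ x_k\prec x_v}\Psi_{S,f}(x_v)$. $E(S)$ is the $n\times n$ matrix with $(i,j)$ entry $1$ if $x_i\preceq x_j$ and $0$ otherwise, and $E(S_i^k)$ is the $(n-1)\times(n-1)$ submatrix of $E(S)$ obtained by deleting the $i$th row and the $k$th column. $\mu_S$ is the Möbius function of the poset $(S,\preceq)$. *)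

theory Defs
  imports "Jordan_Normal_Form.Determinant"
begin

definition locally_finite_order :: "'a::order itself \<Rightarrow> bool" where
  "locally_finite_order _ \<longleftrightarrow> (\<forall>a b :: 'a. finite {a..b})"

definition join_closed :: "'a::lattice set \<Rightarrow> bool" where
  "join_closed S \<longleftrightarrow> (\<forall>x\<in>S. \<forall>y\<in>S. sup x y \<in> S)"

text \<open>An indexed set \<open>{x\<^sub>1, \<dots>, x\<^sub>n}\<close> is given by \<open>n\<close> and an enumeration \<open>x\<close> on the indices
  \<open>0, \<dots>, n - 1\<close>, following the 0-based indexing of matrices. The shift does not change the
  sign \<open>(-1)^(i+j)\<close>.\<close>

definition join_matrix :: "('a::lattice \<Rightarrow> complex) \<Rightarrow> nat \<Rightarrow> (nat \<Rightarrow> 'a) \<Rightarrow> complex mat" where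
  "join_matrix f n x = mat n n (\<lambda>(i, j). f (sup (x i) (x j)))"

definition E_matrix :: "nat \<Rightarrow> (nat \<Rightarrow> 'a::order) \<Rightarrow> complex mat" where
  "E_matrix n x = mat n n (\<lambda>(i, j). if x i \<le> x j then 1 else 0)"

text \<open>The test \<open>finite S\<close> in the next two definitions only serves to make the recursions
  terminate; the values are meant for finite \<open>S\<close> and arguments in \<open>S\<close>.\<close>

function Psi :: "'a::order set \<Rightarrow> ('a \<Rightarrow> complex) \<Rightarrow> 'a \<Rightarrow> complex" where
  "Psi S f x = (if finite S then f x - (\<Sum>v\<in>{v \<in> S. x < v}. Psi S f v) else 0)"
  by pat_completeness auto
termination
proof (relation "measure (\<lambda>(S, f, x). card {v \<in> S. x < v})", goal_cases)
  case (2 S f x v)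
  then have "{w \<in> S. v < w} \<subset> {w \<in> S. x < w}"
    by (auto intro: less_trans)
  with 2 show ?case
    by (simp add: psubset_card_mono)
qed simp

declare Psi.simps [simp del]

function moebius :: "'a::order set \<Rightarrow> 'a \<Rightarrow> 'a \<Rightarrow> complex" where
  "moebius S x y =
    (if \<not> finite S then 0
     else if x = y then 1
     else if x < y then - (\<Sum>z\<in>{z \<in> S. x \<le> z \<and> z < y}. moebius S x z)
     else 0)"
  by pat_completeness auto
termination
proof (relation "measure (\<lambda>(S, x, y). card {z \<in> S. x \<le> z \<and> z < y})", goal_cases)
  case (2 S x y z)
  then have "{w \<in> S. x \<le> w \<and> w < z} \<subset> {w \<in> S. x \<le> w \<and> w < y}"
    by (auto intro: less_trans)
  with 2 show ?case
    by (simp add: psubset_card_mono)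
qed simp

declare moebius.simps [simp del]

end

theory Submission
  imports Defs
begin

text \<open>The recursion for \<open>\<Psi>\<close> says \<open>f y = (\<Sum>v\<in>S. [y \<le> v] \<Psi> v)\<close>, and since \<open>v\<close> bounds \<open>x\<close> and
  \<open>y\<close> iff it bounds their join, \<open>[S]\<^sub>f = E D E\<^sup>T\<close> with \<open>D\<close> the diagonal matrix of the \<open>\<Psi>\<close> values.
  As \<open>E\<close> is upper unitriangular, invertibility of \<open>[S]\<^sub>f\<close> means that no \<open>\<Psi>\<close> value vanishes, and
  its inverse is \<open>M\<^sup>T D\<^sup>-\<^sup>1 M\<close>, where \<open>M = E\<^sup>-\<^sup>1\<close>. The matrix \<open>M\<close> can be read off either from the
  Moebius function or from the cofactors of \<open>E\<close>, which yields the two formulas.\<close>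

lemma sum_Psi_upset:
  assumes "finite S" "y \<in> S"
  shows "(\<Sum>v\<in>{v \<in> S. y \<le> v}. Psi S f v) = f y"
proof -
  have "{v \<in> S. y \<le> v} = insert y {v \<in> S. y < v}"
    using assms by auto
  with assms show ?thesis
    by (simp add: Psi.simps[of S f y])
qed

lemma moebius_neq_0D: "moebius S y z \<noteq> 0 \<Longrightarrow> y \<le> z"
  by (subst (asm) moebius.simps) (auto split: if_splits)

text \<open>Terms with \<open>w\<close> not above \<open>y\<close> vanish, so only the interval from
  \<open>y\<close> to \<open>z\<close> counts: for \<open>y < z\<close> the recursion makes its sum
  zero, otherwise it is \<open>{y}\<close> or empty.\<close>

lemma sum_moebius_downset:
  assumes "finite S" "y \<in> S" "z \<in> S"
  shows "(\<Sum>w\<in>{w \<in> S. w \<le> z}. moebius S y w) = (if y = z then 1 else 0)"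
proof -
  have "(\<Sum>w\<in>{w \<in> S. w \<le> z}. moebius S y w) = (\<Sum>w\<in>{w \<in> S. y \<le> w \<and> w \<le> z}. moebius S y w)"
    using assms by (intro sum.mono_neutral_right) (auto dest: moebius_neq_0D)
  also have "\<dots> = (if y = z then 1 else 0)"
  proof (cases "y < z")
    case True
    then have "{w \<in> S. y \<le> w \<and> w \<le> z} = insert z {w \<in> S. y \<le> w \<and> w < z}"
      using assms by auto
    with True assms show ?thesis
      by (simp add: moebius.simps[of S y z])
  next
    case False
    then have "{w \<in> S. y \<le> w \<and> w \<le> z} = (if y = z then {y} else {})"
      using assms by auto
    with assms show ?thesis
      by (simp add: moebius.simps[of S z z])
  qed
  finally show ?thesis .
qed

text \<open>Turns the sum over indices in a matrix product into a sum over part of \<open>S\<close>;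
  the \<open>if\<close> is the effect of a 0/1 entry of \<open>E_matrix\<close>.\<close>

lemma sum_index_eq_sum_set:
  fixes n :: nat
  assumes "bij_betw x {..<n} S"
  shows "(\<Sum>k<n. if P (x k) then g (x k) else 0) = (\<Sum>v\<in>{v \<in> S. P v}. g v)"
proof -
  have "finite S"
    using bij_betw_finite[OF assms] by simp
  then show ?thesis
    using sum.reindex_bij_betw[OF assms, of "\<lambda>v. if P v then g v else 0"]
    by (simp only: sum.inter_filter)
qed

text \<open>Serves twice: with \<open>A\<close> the matrix \<open>E_matrix\<close> for the join
  matrix, and with \<open>A\<close> the transposed Moebius matrix for its inverse.\<close>

lemma congruence_mat_diag_index:
  fixes A :: "'a::comm_ring_1 mat"
  assumes "A \<in> carrier_mat n n" "i < n" "j < n"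
  shows "(A * mat_diag n d * transpose_mat A) $$ (i, j) = (\<Sum>k<n. A $$ (i, k) * d k * A $$ (j, k))"
  using assms
  by (simp add: mat_diag_mult_right scalar_prod_def lessThan_atLeast0)

lemma E_matrix_carrier [simp]: "E_matrix n x \<in> carrier_mat n n"
  by (simp add: E_matrix_def)

definition moebius_matrix :: "nat \<Rightarrow> (nat \<Rightarrow> 'a::order) \<Rightarrow> complex mat" where
  "moebius_matrix n x = mat n n (\<lambda>(i, j). moebius (x ` {..<n}) (x i) (x j))"

lemma moebius_matrix_carrier [simp]: "moebius_matrix n x \<in> carrier_mat n n"
  by (simp add: moebius_matrix_def)

lemma moebius_matrix_mult_E_matrix:
  assumes "inj_on x {..<n}"
  shows "moebius_matrix n x * E_matrix n x = 1\<^sub>m n"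
proof (intro eq_matI)
  fix i j assume "i < dim_row (1\<^sub>m n :: complex mat)" "j < dim_col (1\<^sub>m n :: complex mat)"
  then have ij: "i < n" "j < n" by auto
  define S where "S = x ` {..<n}"
  have bij: "bij_betw x {..<n} S"
    using assms by (simp add: S_def bij_betw_def)
  have "(moebius_matrix n x * E_matrix n x) $$ (i, j) =
      (\<Sum>k<n. if x k \<le> x j then moebius S (x i) (x k) else 0)"
    using ij by (auto simp: moebius_matrix_def E_matrix_def S_def scalar_prod_def lessThan_atLeast0
        intro!: sum.cong)
  also have "\<dots> = (if x i = x j then 1 else 0)"
    using ij sum_index_eq_sum_set[OF bij, of "\<lambda>v. v \<le> x j" "moebius S (x i)"]
    by (simp add: sum_moebius_downset S_def)
  also have "\<dots> = 1\<^sub>m n $$ (i, j)"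
    using ij assms by (simp add: inj_on_eq_iff)
  finally show "(moebius_matrix n x * E_matrix n x) $$ (i, j) = 1\<^sub>m n $$ (i, j)" .
qed (simp_all add: moebius_matrix_def E_matrix_def)

lemma det_E_matrix:
  assumes "\<forall>i<n. \<forall>j<n. x i \<le> x j \<longrightarrow> i \<le> j"
  shows "det (E_matrix n x) = 1"
proof -
  have "upper_triangular (E_matrix n x)"
    \<comment> \<open>For \<open>j < i\<close>, \<open>x i \<le> x j\<close> would force
      \<open>i \<le> j\<close>, so entries below the diagonal are 0.\<close>
    using assms by (simp add: E_matrix_def upper_triangular_def) (meson leD less_trans)
  moreover have "diag_mat (E_matrix n x) = replicate n 1"
    by (simp add: diag_mat_def E_matrix_def list_eq_iff_nth_eq)
  ultimately show ?thesis
    using det_upper_triangular[OF _ E_matrix_carrier, of n x] by simp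
qed

text \<open>As \<open>E_matrix\<close> has determinant 1, its adjugate is a right inverse, which
  must agree with the left inverse \<open>moebius_matrix\<close>.\<close>

lemma moebius_eq_cofactor_E_matrix:
  assumes "inj_on x {..<n}" "\<forall>i<n. \<forall>j<n. x i \<le> x j \<longrightarrow> i \<le> j" "i < n" "k < n"
  shows "moebius (x ` {..<n}) (x k) (x i) = (-1) ^ (i + k) * det (mat_delete (E_matrix n x) i k)"
proof -
  let ?E = "E_matrix n x" and ?M = "moebius_matrix n x"
  note adj = adj_mat[OF E_matrix_carrier, of n x]
  have "?E * adj_mat ?E = 1\<^sub>m n"
    using adj(2) det_E_matrix[OF assms(2)] by (auto intro!: eq_matI)
  then have "?M = ?M * (?E * adj_mat ?E)"
    by (simp add: right_mult_one_mat[OF moebius_matrix_carrier])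
  also have "\<dots> = (?M * ?E) * adj_mat ?E"
    using adj(1) by (simp add: assoc_mult_mat[of _ n n _ n _ n] mult_carrier_mat[of _ n n _ n])
  also have "\<dots> = adj_mat ?E"
    using adj(1) by (simp add: moebius_matrix_mult_E_matrix[OF assms(1)])
  finally have "?M $$ (k, i) = adj_mat ?E $$ (k, i)" by simp
  \<comment> \<open>The adjugate is the transposed cofactor matrix, so its entry
    \<open>(k, i)\<close> comes from deleting row \<open>i\<close> and column
    \<open>k\<close>.\<close>
  then show ?thesis
    using assms by (simp add: moebius_matrix_def adj_mat_def cofactor_def E_matrix_def)
qed

lemma join_matrix_decomposition:
  assumes bij: "bij_betw x {..<n} S" and "join_closed S"
  shows "join_matrix f n x =
    E_matrix n x * mat_diag n (\<lambda>k. Psi S f (x k)) * transpose_mat (E_matrix n x)" (is "_ = ?R")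
proof (intro eq_matI)
  fix i j assume "i < dim_row ?R" "j < dim_col ?R"
  then have ij: "i < n" "j < n" by (auto simp: E_matrix_def)
  have fin: "finite S" and sup: "sup (x i) (x j) \<in> S"
    using assms ij bij_betw_finite[OF bij] bij_betwE[OF bij] by (auto simp: join_closed_def)
  have "?R $$ (i, j) = (\<Sum>k<n. if sup (x i) (x j) \<le> x k then Psi S f (x k) else 0)"
    unfolding congruence_mat_diag_index[OF E_matrix_carrier ij]
    using ij by (intro sum.cong) (auto simp: E_matrix_def)
  \<comment> \<open>Join-closedness enters here: the Psi sum can be evaluated at the join because it
    lies in \<open>S\<close>.\<close>
  also have "\<dots> = f (sup (x i) (x j))"
    using sum_index_eq_sum_set[OF bij, of "\<lambda>v. sup (x i) (x j) \<le> v" "Psi S f"]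
      sum_Psi_upset[OF fin sup, of f] by simp
  finally show "join_matrix f n x $$ (i, j) = ?R $$ (i, j)"
    using ij by (simp add: join_matrix_def)
qed (simp_all add: join_matrix_def E_matrix_def)

text \<open>The product collapses from the middle: first \<open>M * E\<close>, then the two diagonal
  factors. What is left is the transpose of \<open>E * M\<close>, the identity since the matrices
  are square.\<close>

lemma congruence_mat_diag_inverse:
  fixes E M :: "'a::field mat"
  assumes E: "E \<in> carrier_mat n n" and M: "M \<in> carrier_mat n n"
    and ME: "M * E = 1\<^sub>m n" and d: "\<forall>k<n. d k \<noteq> 0"
  shows "(transpose_mat M * mat_diag n (\<lambda>k. 1 / d k) * M) *
    (E * mat_diag n d * transpose_mat E) = 1\<^sub>m n"
proof -
  let ?D = "mat_diag n d" and ?D' = "mat_diag n (\<lambda>k. 1 / d k)"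
  have EM: "E * M = 1\<^sub>m n"
    using mat_mult_left_right_inverse[OF M E ME] .
  have D'D: "?D' * ?D = 1\<^sub>m n"
    using d by (simp only: mat_diag_diag) (auto simp: mat_diag_def intro!: eq_matI)
  have "(transpose_mat M * ?D' * M) * (E * ?D * transpose_mat E) =
      transpose_mat M * (?D' * ((M * E) * (?D * transpose_mat E)))"
    using E M by (simp add: assoc_mult_mat[of _ n n _ n _ n] mult_carrier_mat[of _ n n _ n])
  also have "\<dots> = transpose_mat M * ((?D' * ?D) * transpose_mat E)"
    using E M by (simp add: ME assoc_mult_mat[of _ n n _ n _ n] mult_carrier_mat[of _ n n _ n]
        left_mult_one_mat[of _ n n] del: mat_diag_diag)
  also have "\<dots> = transpose_mat (E * M)"
    using E M by (simp add: D'D transpose_mult[OF E M] del: mat_diag_diag)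
  finally show ?thesis by (simp add: EM)
qed

lemma det_neq_0_if_invertible_mat:
  fixes A :: "'a::field mat"
  assumes "A \<in> carrier_mat n n" "invertible_mat A"
  shows "det A \<noteq> 0"
proof -
  obtain B where AB: "A * B = 1\<^sub>m n" and BA: "B * A = 1\<^sub>m (dim_row B)"
    using assms by (auto simp: invertible_mat_def inverts_mat_def)
  \<comment> \<open>The witness \<open>B\<close> comes without a size; comparing column counts in
    both identities fixes it.\<close>
  have "dim_row B = n" "dim_col B = n"
    using assms(1) arg_cong[OF BA, of dim_col] arg_cong[OF AB, of dim_col] by simp_all
  then have "B \<in> carrier_mat n n"
    by (rule carrier_matI)
  then have "det A * det B = 1"
    using det_mult[OF assms(1), of B] by (simp add: AB)
  then show ?thesis by auto
qed

lemma det_mat_diag: "det (mat_diag n d) = (\<Prod>k<n. d k)"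
proof -
  have "det (mat_diag n d) = prod_list (diag_mat (mat_diag n d))"
    by (rule det_upper_triangular[of _ n]) (auto simp: upper_triangular_def mat_diag_def)
  also have "diag_mat (mat_diag n d) = map d [0..<n]"
    by (simp add: diag_mat_def mat_diag_def)
  finally show ?thesis
    by (simp add: prod.list_conv_set_nth lessThan_atLeast0)
qed

theorem theorem5p3:
  fixes f :: "'a::lattice \<Rightarrow> complex" and S :: "'a set" and n :: nat and x :: "nat \<Rightarrow> 'a"
  assumes "locally_finite_order TYPE('a)"
    and "bij_betw x {..<n} S"
    and "\<forall>i<n. \<forall>j<n. x i \<le> x j \<longrightarrow> i \<le> j"
    and "join_closed S"
    and "invertible_mat (join_matrix f n x)"
  defines "B \<equiv> mat n n (\<lambda>(i, j). \<Sum>k<n. (-1) ^ (i + j) / Psi S f (x k)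
                   * det (mat_delete (E_matrix n x) i k) * det (mat_delete (E_matrix n x) j k))"
    and "C \<equiv> mat n n (\<lambda>(i, j). \<Sum>k | k < n \<and> x k \<le> inf (x i) (x j).
                   moebius S (x k) (x i) * moebius S (x k) (x j) / Psi S f (x k))"
  shows "inverts_mat (join_matrix f n x) B \<and> inverts_mat B (join_matrix f n x) \<and> B = C"
proof -
  let ?J = "join_matrix f n x" and ?E = "E_matrix n x" and ?M = "moebius_matrix n x"
  let ?d = "\<lambda>k. Psi S f (x k)"
  have inj: "inj_on x {..<n}" and S: "x ` {..<n} = S"
    using assms(2) by (auto simp: bij_betw_def)
  have J: "?J \<in> carrier_mat n n" and C: "C \<in> carrier_mat n n"
    by (auto simp: join_matrix_def C_def)
  have decomp: "?J = ?E * mat_diag n ?d * transpose_mat ?E"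
    using assms(2,4) by (rule join_matrix_decomposition)
  \<comment> \<open>Both outer factors have determinant 1, so a nonzero \<open>det ?J\<close>
    excludes a zero among the Psi values.\<close>
  have "det ?J = (\<Prod>k<n. ?d k)"
    unfolding decomp
    by (simp add: det_mult[of _ n] mult_carrier_mat[of _ n n] det_transpose[of _ n]
        det_E_matrix[OF assms(3)] det_mat_diag)
  with det_neq_0_if_invertible_mat[OF J assms(5)] have d: "\<forall>k<n. ?d k \<noteq> 0"
    by auto
  have "C = transpose_mat ?M * mat_diag n (\<lambda>k. 1 / ?d k) * ?M" (is "_ = ?R")
  proof (intro eq_matI)
    fix i j assume "i < dim_row ?R" "j < dim_col ?R"
    then have ij: "i < n" "j < n" by (auto simp: moebius_matrix_def)
    have "?R $$ (i, j) = (\<Sum>k<n. moebius S (x k) (x i) * moebius S (x k) (x j) / ?d k)"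
      using ij congruence_mat_diag_index[of "transpose_mat ?M" n i j "\<lambda>k. 1 / ?d k"]
      by (auto simp: moebius_matrix_def S intro!: sum.cong)
    \<comment> \<open>If \<open>x k\<close> is not below both \<open>x i\<close> and
      \<open>x j\<close>, one Moebius factor is 0, so the sum may be restricted to lower bounds of
      the meet.\<close>
    also have "\<dots> = C $$ (i, j)"
      using ij by (auto simp: C_def dest: moebius_neq_0D intro!: sum.mono_neutral_right)
    finally show "C $$ (i, j) = ?R $$ (i, j)" ..
  qed (simp_all add: C_def moebius_matrix_def)
  then have CJ: "C * ?J = 1\<^sub>m n"
    unfolding decomp
    using congruence_mat_diag_inverse[OF E_matrix_carrier moebius_matrix_carrier
        moebius_matrix_mult_E_matrix[OF inj] d] by simp
  then have JC: "?J * C = 1\<^sub>m n"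
    using mat_mult_left_right_inverse[OF C J] by simp
  have "B = C"
  proof (intro eq_matI)
    fix i j assume "i < dim_row C" "j < dim_col C"
    then have ij: "i < n" "j < n" by (auto simp: C_def)
    have "C $$ (i, j) = (\<Sum>k<n. moebius S (x k) (x i) * moebius S (x k) (x j) / ?d k)"
      using ij by (auto simp: C_def dest: moebius_neq_0D intro!: sum.mono_neutral_left)
    \<comment> \<open>The cofactor signs \<open>(-1) ^ (i + k)\<close> and
      \<open>(-1) ^ (j + k)\<close> multiply to \<open>(-1) ^ (i + j)\<close>.\<close>
    also have "\<dots> = B $$ (i, j)"
      using ij moebius_eq_cofactor_E_matrix[OF inj assms(3)]
      by (auto simp: B_def S power_add intro!: sum.cong)
    finally show "B $$ (i, j) = C $$ (i, j)" ..
  qed (simp_all add: B_def C_def)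
  with CJ JC J C show ?thesis
    by (simp add: inverts_mat_def)
qed

end
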